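(* Let $r\in\,]0,1[$ be any restitution coefficient. Then there exists no point in the domain of $\widehat{\mathfrak{P}}_r$ which generates the periodic orbit $13223122$ in a stable manner.
   Context: Set $\alpha=\frac{1+r}{2}$ and $$P_1=\begin{pmatrix}-r & r\alpha & 0\\ -\alpha & \alpha^2-r & r\alpha\\ 0&0&r^2\end{pmatrix},\quad P_2=\begin{pmatrix} r&-r\alpha&0\\ \alpha&-2\alpha^2+r&\alpha\\ 0&-r\alpha&r\end{pmatrix},\quad P_3=\begin{pmatrix} r^2&0&0\\ r\alpha&\alpha^2-r&-\alpha\\ 0&r\alpha&-r\end{pmatrix}.$$ The mapping $\widehat{\mathfrak{P}}_r$ (the $\mathfrak{b}$-to-$\mathfrak{b}$ mapping) acts on unit vectors $u=(x,y,z)\in\mathbb{S}^2$, considered up to sign and normalized so that $x>0$, $z<0$. It is defined almost everywhere by $\widehat{\mathfrak{P}}_r(u)=P_iu/|P_iu|$, where $i=1$ if $\alpha y-x>0$; $i=3$ if $\alpha y-z<0$; $i=2$ if $\alpha y-x<0$ and $\alpha y-z>0$. These three regions are called the domains of $P_1,P_3,P_2$ respectively. A point $u$ generates the periodic orbit $i_1i_2\cdots i_n$ (with $i_j\in\{1,2,3\}$) if for each $1\le j\le n$ the point $\widehat{\mathfrak{P}}_r^{\,j-1}(u)$ lies in the domain of $P_{i_j}$, and $\widehat{\mathfrak{P}}_r^{\,n}(u)=u$. It does so in a stable manner if $u$ is a locally stable fixed point of $\widehat{\mathfrak{P}}_r^{\,n}$, in the sense that any orbit of $\widehat{\mathfrak{P}}_r^{\,n}$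 starting sufficiently close to $u$ remains close to $u$. *)

theory Defs
  imports "HOL-Analysis.Analysis"
begin

definition restitution_alpha :: "real \<Rightarrow> real" where
  "restitution_alpha r = (1 + r) / 2"

definition bb_matrix :: "real \<Rightarrow> nat \<Rightarrow> real^3^3" where
  "bb_matrix r i = (let \<alpha> = restitution_alpha r in
     if i = 1 then
       vector [vector [- r,   r * \<alpha>,    0],
               vector [- \<alpha>,   \<alpha>^2 - r,  r * \<alpha>],
               vector [0,     0,        r^2]]
     else if i = 2 then
       vector [vector [r,   - r * \<alpha>,        0],
               vector [\<alpha>,   - 2 * \<alpha>^2 + r,  \<alpha>],
               vector [0,   - r * \<alpha>,        r]]
     else if i = 3 then
       vector [vector [r^2,    0,        0],
               vector [r * \<alpha>,  \<alpha>^2 - r,  - \<alpha>],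
               vector [0,      r * \<alpha>,    - r]]
     else undefined)"

text \<open>
  Points of the phase space are unit vectors up to sign, represented by their unique
  representative with positive first and negative third coordinate.
\<close>

definition bb_space :: "(real^3) set" where
  "bb_space = {u. norm u = 1 \<and> u $ 1 > 0 \<and> u $ 3 < 0}"

definition bb_domain :: "real \<Rightarrow> nat \<Rightarrow> (real^3) set" where
  "bb_domain r i = {u \<in> bb_space. let \<alpha> = restitution_alpha r in
       (i = 1 \<and> \<alpha> * u $ 2 - u $ 1 > 0) \<or>
       (i = 2 \<and> \<alpha> * u $ 2 - u $ 1 < 0 \<and> \<alpha> * u $ 2 - u $ 3 > 0) \<or>
       (i = 3 \<and> \<alpha> * u $ 2 - u $ 3 < 0)}"

definition bb_full_domain :: "real \<Rightarrow> (real^3) set" where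
  "bb_full_domain r = bb_domain r 1 \<union> bb_domain r 2 \<union> bb_domain r 3"

text \<open>
  The normalization never changes the sign: for \<open>0 < r\<close> each matrix maps its own domain to
  vectors with positive first and negative third coordinate. The order of the case distinction
  is immaterial, since the three domains are pairwise disjoint for \<open>0 < r\<close>. Outside
  \<open>bb_full_domain r\<close> the value is junk, so every use below guards against leaving that set.
\<close>

definition bb_map :: "real \<Rightarrow> real^3 \<Rightarrow> real^3" where
  "bb_map r u =
     (let normalize = (\<lambda>v. v /\<^sub>R norm v) in
      if u \<in> bb_domain r 1 then normalize (bb_matrix r 1 *v u)
      else if u \<in> bb_domain r 2 then normalize (bb_matrix r 2 *v u)
      else if u \<in> bb_domain r 3 then normalize (bb_matrix r 3 *v u)
      else undefined)"

definition generates_periodic_orbit :: "real \<Rightarrow> nat list \<Rightarrow> real^3 \<Rightarrow> bool" where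
  "generates_periodic_orbit r is u \<longleftrightarrow>
     (\<forall>j < length is. (bb_map r ^^ j) u \<in> bb_domain r (is ! j)) \<and>
     (bb_map r ^^ length is) u = u"

text \<open>
  Stability of \<open>u\<close> as a fixed point of the \<open>n\<close>-th iterate. As the map is only partially
  defined, the points \<open>(bb_map r ^^ (n * k)) v\<close> of an orbit are constrained as long as they are
  defined. Near a point generating a periodic orbit of length \<open>n\<close> the \<open>n\<close>-th iterate is defined on
  a whole neighbourhood, so there it makes no difference whether one additionally demands that
  nearby orbits are defined forever.
\<close>

definition locally_stable :: "real \<Rightarrow> nat \<Rightarrow> real^3 \<Rightarrow> bool" where
  "locally_stable r n u \<longleftrightarrow>
     (\<forall>\<epsilon>>0. \<exists>\<delta>>0. \<forall>v \<in> bb_full_domain r. dist v u < \<delta> \<longrightarrow>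
        (\<forall>k. (\<forall>j < n * k. (bb_map r ^^ j) v \<in> bb_full_domain r) \<longrightarrow>
             dist ((bb_map r ^^ (n * k)) v) u < \<epsilon>))"

definition generates_stably :: "real \<Rightarrow> nat list \<Rightarrow> real^3 \<Rightarrow> bool" where
  "generates_stably r is u \<longleftrightarrow>
     generates_periodic_orbit r is u \<and> locally_stable r (length is) u"

end

theory Submission
  imports Defs
begin

text \<open>
  Up to normalisation an itinerary of the mapping is a product of the matrices \<^term>\<open>bb_matrix r i\<close>,
  and each domain is cut out of the unit sphere by strict linear inequalities. Hence a point
  follows a given word exactly if finitely many linear functionals are positive on it, and it
  generates a periodic orbit if in addition it is an eigenvector, with positive eigenvalue, of the
  matrix of the word. The word \<open>13223122\<close> fails for two different reasons, depending on \<open>r\<close>.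

  For \<open>r \<ge> 1/7\<close> no point at all follows the word. Any four linear functionals on \<open>\<real>\<^sup>3\<close> are linearly
  dependent, and among those that have to be positive there are four with a dependence whose
  coefficients are all nonnegative. One choice works for \<open>r \<ge> 1/5\<close> (\<open>orbit_relation_4\<close>), another for
  \<open>1/7 \<le> r \<le> 1/5\<close> (\<open>orbit_relation_7\<close>).

  For \<open>r < 1/7\<close> a periodic point may exist, but it is unstable. Reversing the order of the coordinates
  exchanges the matrices of \<open>1\<close> and \<open>3\<close> and fixes that of \<open>2\<close>, so the second half \<open>3122\<close> of the word
  is the mirror image of the first half \<open>1322\<close>, and the matrix of the word is the square of
  \<open>B = half_return r\<close>, the matrix of \<open>1322\<close> followed by the reversal. Let \<open>m\<^sup>2\<close> with \<open>m > 0\<close> be the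
  eigenvalue of the periodic point \<open>u\<close>. The vector \<open>m u - B u\<close> is a sum of two vectors that follow
  \<open>1322\<close>, so it does not vanish, and \<open>B\<close> multiplies it by \<open>-m\<close>
  (\<open>half_return_negative_eigenvector\<close>). Thus \<open>-m\<close> is a root of the characteristic polynomial
  \<open>x\<^sup>3 - t x\<^sup>2 - s x + r\<^sup>1\<^sup>4\<close> of \<open>B\<close>. For \<open>r < 1/7\<close> one has \<open>t, s > 0\<close> and \<open>t s > r\<^sup>1\<^sup>4\<close>, which forces a
  second root \<open>b > m\<close> (\<open>negative_root_dominated\<close>). Its square is an eigenvalue of the matrix of
  the word larger than that of \<open>u\<close>, and a small perturbation of \<open>u\<close> towards the corresponding
  eigenvector is pulled away from \<open>u\<close> (\<open>larger_eigenvalue_not_locally_stable\<close>).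
\<close>

section \<open>The domains as cones\<close>

definition lead :: "real \<Rightarrow> real^3 \<Rightarrow> real" where
  "lead r u = restitution_alpha r * u $ 2 - u $ 1"

definition trail :: "real \<Rightarrow> real^3 \<Rightarrow> real" where
  "trail r u = restitution_alpha r * u $ 2 - u $ 3"

text \<open>
  Dropping the normalisation turns the domains into open convex cones, on which the mapping is
  linear up to a positive factor.
\<close>

definition bb_cone :: "real \<Rightarrow> nat \<Rightarrow> (real^3) set" where
  "bb_cone r i = {u. 0 < u $ 1 \<and> u $ 3 < 0 \<and>
     (i = 1 \<and> lead r u > 0 \<or> i = 2 \<and> lead r u < 0 \<and> trail r u > 0 \<or> i = 3 \<and> trail r u < 0)}"

lemma bb_domain_eq: "bb_domain r i = bb_cone r i \<inter> sphere 0 1"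
  by (auto simp: bb_domain_def bb_space_def bb_cone_def lead_def trail_def Let_def)

lemma lead_trail_linear:
  "lead r (u + v) = lead r u + lead r v" "trail r (u + v) = trail r u + trail r v"
  "lead r (c *\<^sub>R u) = c * lead r u" "trail r (c *\<^sub>R u) = c * trail r u"
  by (simp_all add: lead_def trail_def algebra_simps)

lemma bb_matrix_apply:
  "bb_matrix r (Suc 0) *v u = vector [- r * u$1 + r * restitution_alpha r * u$2,
     - restitution_alpha r * u$1 + ((restitution_alpha r)\<^sup>2 - r) * u$2 + r * restitution_alpha r * u$3, r\<^sup>2 * u$3]"
  "bb_matrix r 2 *v u = vector [r * u$1 - r * restitution_alpha r * u$2,
     restitution_alpha r * u$1 + (- 2 * (restitution_alpha r)\<^sup>2 + r) * u$2 + restitution_alpha r * u$3,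
     - r * restitution_alpha r * u$2 + r * u$3]"
  "bb_matrix r 3 *v u = vector [r\<^sup>2 * u$1,
     r * restitution_alpha r * u$1 + ((restitution_alpha r)\<^sup>2 - r) * u$2 - restitution_alpha r * u$3,
     r * restitution_alpha r * u$2 - r * u$3]"
  by (simp_all add: bb_matrix_def Let_def vec_eq_iff forall_3 matrix_vector_mult_def sum_3)

lemma bb_cone_scaleR: "0 < c \<Longrightarrow> c *\<^sub>R u \<in> bb_cone r i \<longleftrightarrow> u \<in> bb_cone r i"
  by (auto simp: bb_cone_def lead_trail_linear zero_less_mult_iff mult_less_0_iff)

lemma bb_cone_add: "u \<in> bb_cone r i \<Longrightarrow> v \<in> bb_cone r i \<Longrightarrow> u + v \<in> bb_cone r i"
  by (auto simp: bb_cone_def lead_trail_linear)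

lemma bb_cone_nonzero: "u \<in> bb_cone r i \<Longrightarrow> u \<noteq> 0"
  by (auto simp: bb_cone_def)

lemma bb_cone_disjoint: "u \<in> bb_cone r i \<Longrightarrow> u \<in> bb_cone r j \<Longrightarrow> i = j"
  by (auto simp: bb_cone_def lead_def trail_def)

lemma open_bb_cone: "open (bb_cone r i)"
proof -
  have "open {u :: real^3. 0 < u $ 1 \<and> u $ 3 < 0 \<and>
      (P \<and> lead r u > 0 \<or> Q \<and> lead r u < 0 \<and> trail r u > 0 \<or> R \<and> trail r u < 0)}"
    for P Q R
    unfolding lead_def trail_def
    by (intro open_Collect_conj open_Collect_disj open_Collect_less continuous_intros open_Collect_const)
  then show ?thesis unfolding bb_cone_def .
qed

lemma sgn_in_bb_domain: "sgn w \<in> bb_domain r i \<longleftrightarrow> w \<in> bb_cone r i"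
proof (cases "w = 0")
  case True
  then show ?thesis by (auto simp: bb_domain_eq bb_cone_def)
next
  case False
  then show ?thesis
    using bb_cone_scaleR[of "inverse (norm w)" w r i]
    by (simp add: bb_domain_eq norm_sgn) (simp add: sgn_div_norm)
qed

lemma sgn_matrix_sgn: "sgn (A *v sgn w) = sgn (A *v w)" for A :: "real^'n^'m"
  by (cases "w = 0") (simp_all add: sgn_div_norm[of w] matrix_vector_mult_scaleR sgn_scaleR)

lemma sgn_sgn_idem: "sgn (sgn w) = sgn w" for w :: "'a::real_normed_vector"
  by (cases "w = 0") (simp_all add: sgn_div_norm[of "sgn w"] norm_sgn)

lemma bb_map_sgn:
  assumes "w \<in> bb_cone r i"
  shows "bb_map r (sgn w) = sgn (bb_matrix r i *v w)"
proof -
  have "i = 1 \<or> i = 2 \<or> i = 3"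
    using assms by (auto simp: bb_cone_def)
  moreover have "sgn w \<in> bb_domain r j \<longleftrightarrow> i = j" for j
    using assms bb_cone_disjoint sgn_in_bb_domain by metis
  ultimately have "bb_map r (sgn w) = sgn (bb_matrix r i *v sgn w)"
    by (auto simp: bb_map_def Let_def sgn_div_norm[of "bb_matrix r _ *v _"])
  then show ?thesis by (simp add: sgn_matrix_sgn)
qed

section \<open>Itineraries without normalisation\<close>

primrec word_matrix :: "real \<Rightarrow> nat list \<Rightarrow> real^3^3" where
  "word_matrix r [] = mat 1"
| "word_matrix r (i # is) = word_matrix r is ** bb_matrix r i"

primrec follows :: "real \<Rightarrow> nat list \<Rightarrow> real^3 \<Rightarrow> bool" where
  "follows r [] w \<longleftrightarrow> True"
| "follows r (i # is) w \<longleftrightarrow> w \<in> bb_cone r i \<and> follows r is (bb_matrix r i *v w)"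

lemma word_matrix_apply:
  "word_matrix r [] *v u = u"
  "word_matrix r (i # is) *v u = word_matrix r is *v (bb_matrix r i *v u)"
  by (simp_all add: matrix_vector_mul_assoc)

lemma follows_append:
  "follows r (is @ js) w \<longleftrightarrow> follows r is w \<and> follows r js (word_matrix r is *v w)"
  by (induction "is" arbitrary: w) (simp_all add: matrix_vector_mul_assoc)

lemma follows_add: "follows r is u \<Longrightarrow> follows r is v \<Longrightarrow> follows r is (u + v)"
  by (induction "is" arbitrary: u v) (simp_all add: bb_cone_add matrix_vector_right_distrib)

lemma follows_scaleR: "0 < c \<Longrightarrow> follows r is (c *\<^sub>R u) \<longleftrightarrow> follows r is u"
  by (induction "is" arbitrary: u) (simp_all add: bb_cone_scaleR matrix_vector_mult_scaleR)

text \<open>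
  Following a word is an open condition, so orbits that start near a periodic point keep its itinerary as
  long as they return close to it.
\<close>

lemma open_follows: "open {w. follows r is w}"
proof (induction "is")
  case (Cons i "is")
  have "open ((*v) (bb_matrix r i) -` {w. follows r is w})"
    by (intro open_vimage Cons.IH) (simp add: matrix_vector_mult_linear_continuous_on)
  then show ?case
    using open_Int[OF open_bb_cone[of r i]] by (simp add: Collect_conj_eq vimage_def)
qed simp

text \<open>
  The mapping commutes with positive rescaling, so all normalisations along an orbit can be
  postponed to its end.
\<close>

lemma bb_map_funpow_sgn:
  assumes "follows r is w"
  shows "(bb_map r ^^ length is) (sgn w) = sgn (word_matrix r is *v w)"
    and "j < length is \<Longrightarrow> (bb_map r ^^ j) (sgn w) \<in> bb_domain r (is ! j)"
proof -
  have "(bb_map r ^^ length is) (sgn w) = sgn (word_matrix r is *v w) \<and>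
      (\<forall>j < length is. (bb_map r ^^ j) (sgn w) \<in> bb_domain r (is ! j))"
    using assms
  proof (induction "is" arbitrary: w)
    case (Cons i "is")
    then have step: "bb_map r (sgn w) = sgn (bb_matrix r i *v w)" and "w \<in> bb_cone r i"
      and rest: "follows r is (bb_matrix r i *v w)"
      by (auto intro: bb_map_sgn)
    then have "(bb_map r ^^ j) (sgn w) \<in> bb_domain r ((i # is) ! j)" if "j < Suc (length is)" for j
      using that Cons.IH[OF rest]
      by (cases j) (simp_all del: funpow.simps(2) add: funpow_Suc_right sgn_in_bb_domain)
    then show ?case
      using Cons.IH[OF rest] step
      by (simp del: funpow.simps add: funpow_Suc_right matrix_vector_mul_assoc)
  qed simp
  then show "(bb_map r ^^ length is) (sgn w) = sgn (word_matrix r is *v w)"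
    and "j < length is \<Longrightarrow> (bb_map r ^^ j) (sgn w) \<in> bb_domain r (is ! j)"
    by blast+
qed

lemma followsI:
  assumes "\<And>j. j < length is \<Longrightarrow> (bb_map r ^^ j) (sgn w) \<in> bb_domain r (is ! j)"
  shows "follows r is w"
  using assms
proof (induction "is" arbitrary: w)
  case (Cons i "is")
  have "w \<in> bb_cone r i"
    using Cons.prems[of 0] by (simp add: sgn_in_bb_domain)
  moreover have "(bb_map r ^^ j) (sgn (bb_matrix r i *v w)) \<in> bb_domain r (is ! j)" if "j < length is" for j
    using Cons.prems[of "Suc j"] that bb_map_sgn[OF calculation]
    by (simp del: funpow.simps add: funpow_Suc_right)
  ultimately show ?case using Cons.IH by simp
qed simp

lemma bb_domain_subset_full: "bb_domain r i \<subseteq> bb_full_domain r"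
  by (auto simp: bb_full_domain_def bb_domain_eq bb_cone_def)

lemma generates_periodic_orbitD:
  assumes "generates_periodic_orbit r is u" and "sgn u = u" "u \<noteq> 0"
  shows "follows r is u" and "\<exists>c>0. word_matrix r is *v u = c *\<^sub>R u"
proof -
  show *: "follows r is u"
    using assms by (intro followsI) (simp add: generates_periodic_orbit_def)
  have "sgn (word_matrix r is *v u) = u"
    using bb_map_funpow_sgn(1)[OF *] assms by (simp add: generates_periodic_orbit_def)
  moreover from this have "word_matrix r is *v u \<noteq> 0"
    using \<open>u \<noteq> 0\<close> by auto
  moreover have "word_matrix r is *v u = norm (word_matrix r is *v u) *\<^sub>R sgn (word_matrix r is *v u)"
    by (cases "word_matrix r is *v u = 0") (simp_all add: sgn_div_norm)
  ultimately show "\<exists>c>0. word_matrix r is *v u = c *\<^sub>R u"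
    by (metis zero_less_norm_iff)
qed

section \<open>Instability from a larger eigenvalue\<close>

text \<open>
  Start at the direction of \<open>u + t e\<close> with \<open>t > 0\<close> small. If \<open>u\<close> were stable, the orbit would return
  near \<open>u\<close> after each period and hence follow the word forever, so after \<open>k\<close> periods it would be at the
  direction of \<open>l\<^sup>k u + t m\<^sup>k e\<close>. As \<open>l < m\<close>, this direction tends to that of \<open>e\<close>, which differs from
  \<open>u\<close>.
\<close>

lemma larger_eigenvalue_not_locally_stable:
  fixes l m :: real
  assumes "follows r is u" and "sgn u = u" "u \<noteq> 0"
    and u: "word_matrix r is *v u = l *\<^sub>R u" and e: "word_matrix r is *v e = m *\<^sub>R e"
    and "e \<noteq> 0" and lm: "0 < l" "l < m"
  shows "\<not> locally_stable r (length is) u"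
proof
  define N where "N = length is"
  assume "locally_stable r (length is) u"
  then have stable: "\<forall>\<epsilon>>0. \<exists>\<delta>>0. \<forall>v \<in> bb_full_domain r. dist v u < \<delta> \<longrightarrow>
        (\<forall>k. (\<forall>j < N * k. (bb_map r ^^ j) v \<in> bb_full_domain r) \<longrightarrow>
             dist ((bb_map r ^^ (N * k)) v) u < \<epsilon>)"
    unfolding locally_stable_def N_def .
  obtain \<epsilon>0 where \<epsilon>0: "\<epsilon>0 > 0" "ball u \<epsilon>0 \<subseteq> {w. follows r is w}"
    using open_follows assms(1) by (metis mem_Collect_eq open_contains_ball)
  have "sgn e \<noteq> u"
  proof
    assume "sgn e = u"
    then have "word_matrix r is *v (norm e *\<^sub>R u) = m *\<^sub>R (norm e *\<^sub>R u)"
      using e \<open>e \<noteq> 0\<close> by (auto simp: sgn_div_norm)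
    then have "l *\<^sub>R (norm e *\<^sub>R u) = m *\<^sub>R (norm e *\<^sub>R u)"
      using u by (simp add: matrix_vector_mult_scaleR mult.commute)
    moreover have "norm e *\<^sub>R u \<noteq> 0"
      using \<open>sgn e = u\<close> \<open>e \<noteq> 0\<close> by (auto simp: sgn_zero_iff)
    ultimately show False using lm by simp
  qed
  \<comment> \<open>Within \<open>\<epsilon>\<close> of \<open>u\<close> the itinerary is that of \<open>u\<close>, while the direction of \<open>e\<close> stays outside.\<close>
  define \<epsilon> where "\<epsilon> = min \<epsilon>0 (dist (sgn e) u / 2)"
  have \<epsilon>: "0 < \<epsilon>" "\<epsilon> \<le> \<epsilon>0" "\<epsilon> < dist (sgn e) u"
    using \<epsilon>0 \<open>sgn e \<noteq> u\<close> by (auto simp: \<epsilon>_def min_less_iff_disj)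
  obtain \<delta> where \<delta>: "\<delta> > 0" "\<And>v k. v \<in> bb_full_domain r \<Longrightarrow> dist v u < \<delta> \<Longrightarrow>
      (\<And>j. j < N * k \<Longrightarrow> (bb_map r ^^ j) v \<in> bb_full_domain r) \<Longrightarrow> dist ((bb_map r ^^ (N * k)) v) u < \<epsilon>"
    using stable \<epsilon>(1) by meson
  have "((\<lambda>t. sgn (u + t *\<^sub>R e)) \<longlongrightarrow> sgn (u + 0 *\<^sub>R e)) (at_right 0)"
    using \<open>u \<noteq> 0\<close> by (intro tendsto_intros) simp
  then have "\<forall>\<^sub>F t in at_right 0. dist (sgn (u + t *\<^sub>R e)) u < min \<delta> \<epsilon>"
    using \<delta>(1) \<epsilon>(1) assms(2) by (intro tendstoD) simp_all
  then have "\<forall>\<^sub>F t in at_right 0. 0 < t \<and> dist (sgn (u + t *\<^sub>R e)) u < min \<delta> \<epsilon>"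
    by (intro eventually_conj eventually_at_right_less)
  then obtain t :: real where t: "0 < t" "dist (sgn (u + t *\<^sub>R e)) u < \<delta>" "dist (sgn (u + t *\<^sub>R e)) u < \<epsilon>"
    using eventually_happens[of _ "at_right (0::real)"] trivial_limit_at_right_real[of 0]
    by (metis (no_types, lifting) min_less_iff_conj)
  define w where "w k = l ^ k *\<^sub>R u + (t * m ^ k) *\<^sub>R e" for k
  have w_Suc: "word_matrix r is *v w k = w (Suc k)" for k
    by (simp add: w_def matrix_vector_right_distrib matrix_vector_mult_scaleR u e mult_ac)
  have near: "follows r is (sgn (w k))" if "dist (sgn (w k)) u < \<epsilon>" for k
    using that \<epsilon>(2) \<epsilon>0(2) by (auto simp: subset_iff dist_commute)
  have "is \<noteq> []"
  proof
    assume "is = []"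
    then have "1 *\<^sub>R u = l *\<^sub>R u" "1 *\<^sub>R e = m *\<^sub>R e"
      using u e by simp_all
    then have "1 = l" "1 = m"
      using \<open>u \<noteq> 0\<close> \<open>e \<noteq> 0\<close> scaleR_cancel_right by blast+
    then show False using lm by simp
  qed
  have full: "sgn (w 0) \<in> bb_full_domain r"
  proof -
    have "follows r is (sgn (w 0))"
      using near[of 0] t by (simp add: w_def)
    then have "(bb_map r ^^ 0) (sgn (sgn (w 0))) \<in> bb_domain r (is ! 0)"
      using \<open>is \<noteq> []\<close> by (intro bb_map_funpow_sgn(2)) auto
    then show ?thesis using bb_domain_subset_full by (auto simp: sgn_sgn_idem)
  qed
  have orbit: "(bb_map r ^^ (N * k)) (sgn (w 0)) = sgn (w k) \<and>
      (\<forall>j < N * k. (bb_map r ^^ j) (sgn (w 0)) \<in> bb_full_domain r)" for k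
  proof (induction k)
    case (Suc k)
    have "dist (sgn (w k)) u < \<epsilon>"
      using \<delta>(2)[OF full, of k] Suc t by (simp add: w_def)
    note f = bb_map_funpow_sgn[OF near[OF this], unfolded sgn_sgn_idem sgn_matrix_sgn]
    have "(bb_map r ^^ j) (sgn (w 0)) \<in> bb_full_domain r" if "j < N * Suc k" for j
    proof (cases "j < N * k")
      case False
      then obtain i where i: "j = i + N * k" by (metis add.commute le_add_diff_inverse not_less)
      then have "i < length is" using that by (simp add: N_def)
      then have "(bb_map r ^^ i) (sgn (w k)) \<in> bb_full_domain r"
        using f(2) bb_domain_subset_full by auto
      then show ?thesis using Suc i by (simp add: funpow_add)
    qed (use Suc in blast)
    moreover have "(bb_map r ^^ (N * Suc k)) (sgn (w 0)) = sgn (w (Suc k))"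
      using f(1) Suc by (simp add: funpow_add N_def w_Suc)
    ultimately show ?case by blast
  qed simp
  then have bound: "dist (sgn (w k)) u \<le> \<epsilon>" for k
  proof -
    have "dist (sgn (w 0)) u < \<delta>" using t by (simp add: w_def)
    then show ?thesis using \<delta>(2)[OF full, of k] orbit[of k] by simp
  qed
  have "sgn (w k) = sgn ((l / m) ^ k *\<^sub>R u + t *\<^sub>R e)" for k
  proof -
    have "w k = m ^ k *\<^sub>R ((l / m) ^ k *\<^sub>R u + t *\<^sub>R e)"
      using lm by (simp add: w_def scaleR_add_right power_divide mult.commute)
    then show ?thesis using lm by (simp add: sgn_scaleR)
  qed
  moreover have "(\<lambda>k. sgn ((l / m) ^ k *\<^sub>R u + t *\<^sub>R e)) \<longlonglongrightarrow> sgn (0 *\<^sub>R u + t *\<^sub>R e)"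
    using lm t \<open>e \<noteq> 0\<close> by (intro tendsto_intros LIMSEQ_power_zero) auto
  ultimately have "(\<lambda>k. sgn (w k)) \<longlonglongrightarrow> sgn e"
    using t by (simp add: sgn_scaleR)
  then have "(\<lambda>k. dist (sgn (w k)) u) \<longlonglongrightarrow> dist (sgn e) u"
    by (intro tendsto_dist tendsto_const)
  then have "dist (sgn e) u \<le> \<epsilon>"
    using bound by (intro LIMSEQ_le_const2) auto
  then show False using \<epsilon>(3) by simp
qed

section \<open>The itinerary is impossible for large restitution\<close>

text \<open>
  In both relations below every linear form is written with the sign that makes it positive on a point
  following \<open>13223122\<close>. The coefficients are the \<open>3 \<times> 3\<close> minors of the four forms, divided by their
  common factor. Here the third one is nonnegative for \<open>3 - 2 \<surd>2 \<le> r < 1\<close>, where \<open>3 - 2 \<surd>2 \<approx> 0.172\<close>.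
\<close>

lemma orbit_relation_4:
  "2 * r^4 * (1 + r^2) * (- u $ 3) + r^3 * (1 - r)^4 * lead r u
    + (1 + r^2) * (6 * r - 1 - r^2) * (- lead r (word_matrix r [1, 3] *v u))
    + 4 * (- trail r (word_matrix r [1, 3, 2, 2] *v u)) = 0"
proof -
  define a where "a = restitution_alpha r"
  \<comment> \<open>Writing everything in \<open>a\<close> avoids the denominators that \<open>a = (1 + r) / 2\<close> would introduce.\<close>
  have r: "r = 2 * a - 1" by (simp add: a_def restitution_alpha_def field_simps)
  show ?thesis
    unfolding word_matrix_apply One_nat_def bb_matrix_apply lead_def trail_def vector_3 a_def[symmetric]
    by (unfold r, algebra)
qed

text \<open>
  Here the coefficients are all positive for \<open>r\<close> roughly between \<open>0.140\<close> and \<open>0.233\<close>. Below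
  \<open>1/7\<close> instability takes over.
\<close>

lemma orbit_relation_7:
  "64 * r^9 * (- u $ 3)
    + r^2 * (1 - r)^2 * (1 + r)^2 * (5 - 26 * r + 22 * r^2 - 10 * r^3 + r^4)
        * (- lead r (word_matrix r [1, 3, 2] *v u))
    + (1 + r^2) * (- 1 + 10 * r - 19 * r^2 - 4 * r^3 - 39 * r^4 + 26 * r^5 - 5 * r^6)
        * (- trail r (word_matrix r [1, 3, 2, 2] *v u))
    + 32 * (1 - r)^2 * trail r (word_matrix r [1, 3, 2, 2, 3, 1, 2] *v u) = 0"
proof -
  define a where "a = restitution_alpha r"
  have r: "r = 2 * a - 1" by (simp add: a_def restitution_alpha_def field_simps)
  show ?thesis
    unfolding word_matrix_apply One_nat_def bb_matrix_apply lead_def trail_def vector_3 a_def[symmetric]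
    by (unfold r, algebra)
qed

lemma coefficients_7_pos:
  fixes r :: real
  assumes "1/7 \<le> r" "r \<le> 1/5"
  shows "0 < 5 - 26 * r + 22 * r^2 - 10 * r^3 + r^4"
    and "0 < - 1 + 10 * r - 19 * r^2 - 4 * r^3 - 39 * r^4 + 26 * r^5 - 5 * r^6"
proof -
  \<comment> \<open>Between \<open>1/7\<close> and \<open>1/5\<close> the square of \<open>r\<close> lies below its chord and above its tangent at \<open>1/5\<close>;
    with this the estimates become linear.\<close>
  have chord: "r^(k + 2) \<le> 12/35 * r^(k + 1) - 1/35 * r^k" for k
  proof -
    have "0 \<le> r^k * ((r - 1/7) * (1/5 - r))" using assms by simp
    also have "\<dots> = 12/35 * r^(k + 1) - 1/35 * r^k - r^(k + 2)"
      by (simp add: field_simps power2_eq_square)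
    finally show ?thesis by simp
  qed
  have c: "r^2 \<le> 12/35 * r - 1/35" "r^3 \<le> 12/35 * r^2 - 1/35 * r" "r^4 \<le> 12/35 * r^3 - 1/35 * r^2"
    using chord[of 0] chord[of 1] chord[of 2] by (simp_all add: eval_nat_numeral)
  have "0 \<le> (r - 1/5)^2" by simp
  moreover have "(r - 1/5)^2 = r^2 - 2/5 * r + 1/25" by algebra
  ultimately have "2/5 * r - 1/25 \<le> r^2" by linarith
  moreover have "r^6 \<le> r^5" "0 < r^5" "0 < r^4"
    using assms by (auto intro!: power_decreasing)
  ultimately show "0 < 5 - 26 * r + 22 * r^2 - 10 * r^3 + r^4"
    and "0 < - 1 + 10 * r - 19 * r^2 - 4 * r^3 - 39 * r^4 + 26 * r^5 - 5 * r^6"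
    using c assms by linarith+
qed

lemma itinerary_impossible:
  assumes "1/7 \<le> r" "r < 1"
  shows "\<not> follows r [1, 3, 2, 2, 3, 1, 2, 2] u"
proof
  assume f: "follows r [1, 3, 2, 2, 3, 1, 2, 2] u"
  then have s: "u $ 3 < 0" "lead r u > 0" "lead r (word_matrix r [1, 3] *v u) < 0"
    "lead r (word_matrix r [1, 3, 2] *v u) < 0" "trail r (word_matrix r [1, 3, 2, 2] *v u) < 0"
    "trail r (word_matrix r [1, 3, 2, 2, 3, 1, 2] *v u) > 0"
    unfolding follows.simps word_matrix_apply bb_cone_def by simp_all
  show False
  proof (cases "r \<le> 1/5")
    case True
    note pos = coefficients_7_pos[OF assms(1) True]
    have "0 < 64 * r^9 * (- u $ 3)" using s assms by (simp add: mult_pos_neg)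
    moreover have "0 \<le> r^2 * (1 - r)^2 * (1 + r)^2 * (5 - 26 * r + 22 * r^2 - 10 * r^3 + r^4)
        * (- lead r (word_matrix r [1, 3, 2] *v u))"
      by (intro mult_nonneg_nonneg zero_le_power2 less_imp_le[OF pos(1)]) (use s in auto)
    moreover have "0 \<le> (1 + r^2) * (- 1 + 10 * r - 19 * r^2 - 4 * r^3 - 39 * r^4 + 26 * r^5 - 5 * r^6)
        * (- trail r (word_matrix r [1, 3, 2, 2] *v u))"
      by (intro mult_nonneg_nonneg add_nonneg_nonneg zero_le_power2 less_imp_le[OF pos(2)]) (use s in auto)
    moreover have "0 \<le> 32 * (1 - r)^2 * trail r (word_matrix r [1, 3, 2, 2, 3, 1, 2] *v u)"
      by (intro mult_nonneg_nonneg) (use s in auto)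
    ultimately show False
      using orbit_relation_7[of r u] by linarith
  next
    case False
    have "r^2 \<le> r" using assms by (simp add: power2_eq_square mult_left_le)
    then have pos: "0 \<le> 6 * r - 1 - r^2" using False by linarith
    have "0 < 2 * r^4 * (1 + r^2) * (- u $ 3)"
      by (intro mult_pos_pos add_pos_nonneg) (use s assms in auto)
    moreover have "0 \<le> r^3 * (1 - r)^4 * lead r u"
      by (intro mult_nonneg_nonneg) (use s assms in auto)
    moreover have "0 \<le> (1 + r^2) * (6 * r - 1 - r^2) * (- lead r (word_matrix r [1, 3] *v u))"
      by (intro mult_nonneg_nonneg add_nonneg_nonneg zero_le_power2 pos) (use s in auto)
    ultimately show False
      using orbit_relation_4[of r u] s by linarith
  qed
qed

section \<open>The mirror symmetry\<close>

definition reversal :: "real^3^3" where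
  "reversal = vector [vector [0, 0, 1], vector [0, 1, 0], vector [1, 0, 0]]"

lemma reversal_apply: "reversal *v u = vector [u$3, u$2, u$1]"
  by (simp add: reversal_def vec_eq_iff forall_3 matrix_vector_mult_def sum_3)

lemma reversal_reversal: "reversal *v (reversal *v u) = u"
  by (simp add: reversal_apply vec_eq_iff forall_3)

lemma reversal_bb_matrix:
  assumes "i \<in> {1, 2, 3}"
  shows "reversal *v (bb_matrix r i *v u) = bb_matrix r (4 - i) *v (reversal *v u)"
  using assms by (auto simp: bb_matrix_apply reversal_apply vec_eq_iff forall_3)

lemma reversal_word_matrix:
  assumes "set is \<subseteq> {1, 2, 3}"
  shows "reversal *v (word_matrix r is *v u) = word_matrix r (map (\<lambda>i. 4 - i) is) *v (reversal *v u)"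
  using assms
  by (induction "is" arbitrary: u) (simp_all add: word_matrix_apply reversal_bb_matrix del: word_matrix.simps)

text \<open>
  The sign brings the reversed vector back to positive first and negative third coordinate.
\<close>

lemma bb_cone_reversal:
  assumes "i \<in> {1, 2, 3}"
  shows "- (reversal *v w) \<in> bb_cone r (4 - i) \<longleftrightarrow> w \<in> bb_cone r i"
  using assms by (auto simp: bb_cone_def lead_def trail_def reversal_apply)

lemma matrix_vector_mult_minus: "A *v (- u) = - (A *v u)" for A :: "real^'n^'m"
  using matrix_vector_mult_scaleR[of A "- 1" u] by simp

lemma follows_reversal:
  assumes "set is \<subseteq> {1, 2, 3}"
  shows "follows r (map (\<lambda>i. 4 - i) is) (- (reversal *v w)) \<longleftrightarrow> follows r is w"
  using assms
proof (induction "is" arbitrary: w)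
  case (Cons i "is")
  then have "i \<in> {1, 2, 3}" by simp
  note i = bb_cone_reversal[OF this] reversal_bb_matrix[OF this, symmetric]
  show ?case using Cons by (simp add: i matrix_vector_mult_minus)
qed simp

text \<open>
  The matrix of the first half of the word, followed by the reversal that moves the point back to where the
  first half begins again.
\<close>

definition half_return :: "real \<Rightarrow> real^3^3" where
  "half_return r = reversal ** word_matrix r [1, 3, 2, 2]"

lemma half_return_apply: "half_return r *v u = reversal *v (word_matrix r [1, 3, 2, 2] *v u)"
  by (simp add: half_return_def matrix_vector_mul_assoc)

lemma half_return_half_return:
  "half_return r *v (half_return r *v u) = word_matrix r [1, 3, 2, 2, 3, 1, 2, 2] *v u"
proof -
  have "half_return r *v (half_return r *v u) = word_matrix r [3, 1, 2, 2] *v (word_matrix r [1, 3, 2, 2] *v u)"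
    unfolding half_return_apply by (simp add: reversal_word_matrix reversal_reversal del: word_matrix.simps)
  then show ?thesis by (simp add: word_matrix_apply del: word_matrix.simps)
qed

section \<open>Eigenvalues of the half return\<close>

definition half_return_trace :: "real \<Rightarrow> real" where
  "half_return_trace r =
    (1 - 10 * r + 30 * r^2 - 38 * r^3 - 24 * r^4 + 58 * r^5 + 18 * r^6 - 42 * r^7 + 7 * r^8) / 64"

text \<open>
  Minus the sum of the principal \<open>2 \<times> 2\<close> minors; the polynomial in parentheses is that of the trace with
  its coefficients in reverse order.
\<close>

definition half_return_neg_minors :: "real \<Rightarrow> real" where
  "half_return_neg_minors r =
    r^6 * (7 - 42 * r + 18 * r^2 + 58 * r^3 - 24 * r^4 - 38 * r^5 + 30 * r^6 - 10 * r^7 + r^8) / 64"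

text \<open>
  Entries read off from images of basis vectors let the determinant below be expanded without
  multiplying out the product of five matrices.
\<close>

lemma matrix_entry: "A $ i $ j = (A *v axis j 1) $ i" for A :: "real^'n^'m"
  by (simp add: matrix_vector_mult_basis column_def)

lemma det_half_return:
  "det (half_return r - mat x) = - (x^3) + half_return_trace r * x^2 + half_return_neg_minors r * x - r^14"
proof -
  define a where "a = restitution_alpha r"
  have r: "r = 2 * a - 1" by (simp add: a_def restitution_alpha_def field_simps)
  show ?thesis
    unfolding det_3 vector_minus_component matrix_entry[of "half_return r"] half_return_apply
      word_matrix_apply One_nat_def bb_matrix_apply reversal_apply vector_3 a_def[symmetric]
      half_return_trace_def half_return_neg_minors_def
    by (simp add: axis_def mat_def, unfold r, algebra)
qed

lemma singular_iff: "det A = 0 \<longleftrightarrow> (\<exists>x. x \<noteq> 0 \<and> A *v x = 0)" for A :: "real^'n^'n"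
  using invertible_det_nz[of A] invertible_left_inverse[of A] matrix_left_invertible_ker[of A] by blast

lemma half_return_eigenvalue_iff:
  "(\<exists>e. e \<noteq> 0 \<and> half_return r *v e = x *\<^sub>R e) \<longleftrightarrow>
    x^3 - half_return_trace r * x^2 - half_return_neg_minors r * x + r^14 = 0"
proof -
  have mx: "mat x *v e = x *\<^sub>R e" for e :: "real^3"
    by (simp add: vec_eq_iff forall_3 matrix_vector_mult_def sum_3 mat_def)
  have "x^3 - half_return_trace r * x^2 - half_return_neg_minors r * x + r^14 = 0 \<longleftrightarrow>
      det (half_return r - mat x) = 0"
    by (simp add: det_half_return algebra_simps) argo
  also have "\<dots> \<longleftrightarrow> (\<exists>e. e \<noteq> 0 \<and> half_return r *v e = x *\<^sub>R e)"
    by (simp add: singular_iff matrix_vector_mult_diff_rdistrib mx)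
  finally show ?thesis ..
qed

text \<open>
  The trace is positive until \<open>r\<close> exceeds \<open>0.16\<close>, and for small \<open>r\<close> the product is of order
  \<open>r\<^sup>6\<close>, far larger than \<open>r\<^sup>1\<^sup>4\<close>.
\<close>

lemma trace_times_neg_minors_large:
  assumes "0 < r" "r < 1 / 7"
  shows "0 < half_return_trace r" "0 < half_return_neg_minors r"
    and "r^14 < half_return_trace r * half_return_neg_minors r"
proof -
  have pow: "0 < r^k" "r^k \<le> (1/7)^k" for k
    using assms by (auto intro: power_mono)
  have le: "r^3 \<le> 1/343" "r^4 \<le> 1/2401" "r^5 \<le> 1/16807" "r^7 \<le> 1/823543"
    using pow(2)[of 3] pow(2)[of 4] pow(2)[of 5] pow(2)[of 7] by (simp_all add: power_divide)
  \<comment> \<open>The square lies above its tangent at \<open>1/7\<close>, the end where the trace is smallest.\<close>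
  have "0 \<le> (r - 1/7)^2" by simp
  then have "r^2 \<ge> 2/7 * r - 1/49" by (simp add: power2_eq_square algebra_simps)
  then have "1 - 10 * r + 30 * r^2 - 38 * r^3 - 24 * r^4 + 58 * r^5 + 18 * r^6 - 42 * r^7 + 7 * r^8 \<ge> 1/20"
    using le pow(1)[of 5] pow(1)[of 6] pow(1)[of 8] assms by linarith
  then have T: "half_return_trace r \<ge> (1/20) / 64"
    unfolding half_return_trace_def by (intro divide_right_mono) auto
  have "7 - 42 * r + 18 * r^2 + 58 * r^3 - 24 * r^4 - 38 * r^5 + 30 * r^6 - 10 * r^7 + r^8 \<ge> 9/10"
    using le pow(1)[of 2] pow(1)[of 3] pow(1)[of 6] pow(1)[of 8] assms by linarith
  then have S: "half_return_neg_minors r \<ge> r^6 * (9/10) / 64"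
    unfolding half_return_neg_minors_def using pow(1)[of 6]
    by (intro divide_right_mono mult_left_mono) auto
  have "r^14 = r^6 * r^8" by (simp flip: power_add)
  also have "\<dots> \<le> r^6 * (1/7)^8" using pow[of 6] pow[of 8] by (intro mult_left_mono) auto
  also have "\<dots> < ((1/20) / 64) * (r^6 * (9/10) / 64)"
    using pow(1)[of 6] by (simp add: power_divide)
  also have "\<dots> \<le> half_return_trace r * half_return_neg_minors r"
    using T S pow(1)[of 6] by (intro mult_mono) auto
  finally show "r^14 < half_return_trace r * half_return_neg_minors r" .
  show "0 < half_return_trace r" using T by simp
  show "0 < half_return_neg_minors r" using S pow(1)[of 6] by (smt (verit) divide_pos_pos mult_pos_pos)
qed

text \<open>
  Let \<open>p x = x\<^sup>3 - t x\<^sup>2 - s x + d\<close>. From \<open>p (- m) = 0\<close> one gets \<open>p m = 2 (d - t m\<^sup>2) = 2 m (m\<^sup>2 - s)\<close>. If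
  this were nonnegative, then \<open>t s \<le> t m\<^sup>2 \<le> d\<close>, contrary to \<open>d < t s\<close>. So \<open>p m < 0\<close>, and \<open>p\<close> has
  a root to the right of \<open>m\<close>.
\<close>

lemma negative_root_dominated:
  fixes m s t d :: real
  assumes "0 < m" "0 < t" "0 < s" "0 < d" "d < t * s"
    and root: "(- m)^3 - t * (- m)^2 - s * (- m) + d = 0"
  obtains b where "m < b" "b^3 - t * b^2 - s * b + d = 0"
proof -
  define p where "p x = x^3 - t * x^2 - s * x + d" for x
  have root': "m^3 + t * m^2 = s * m + d" using root by (simp add: power2_eq_square power3_eq_cube)
  have "p m < 0"
  proof (rule ccontr)
    assume "\<not> p m < 0"
    then have "t * m^2 \<le> d" and *: "s * m \<le> m^2 * m"
      using root' unfolding p_def by (simp_all add: power2_eq_square power3_eq_cube)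
    from * have "s \<le> m^2" using \<open>0 < m\<close> by simp
    then have "t * s \<le> t * m^2" using \<open>0 < t\<close> by simp
    with \<open>t * m^2 \<le> d\<close> \<open>d < t * s\<close> show False by simp
  qed
  \<comment> \<open>A point beyond \<open>m\<close> where the cubic term dominates.\<close>
  define c where "c = 1 + m + t + s"
  have "c > 0" "m < c" using assms by (simp_all add: c_def)
  have "t * c + s * 1 \<le> t * c + s * c"
    using assms by (intro add_left_mono mult_left_mono) (auto simp: c_def)
  also have "\<dots> \<le> c * c" using assms by (simp add: c_def algebra_simps)
  finally have "0 \<le> c * (c * c - t * c - s)" using \<open>c > 0\<close> by simp
  then have "0 \<le> p c" using \<open>0 < d\<close> by (simp add: p_def power2_eq_square power3_eq_cube algebra_simps)
  moreover have "continuous_on {m..c} p" unfolding p_def by (intro continuous_intros)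
  ultimately obtain b where "m \<le> b" "p b = 0"
    using IVT'[of p m 0 c] \<open>p m < 0\<close> \<open>m < c\<close> by auto
  then show ?thesis using that \<open>p m < 0\<close> unfolding p_def by (metis less_eq_real_def less_irrefl)
qed

section \<open>No stable periodic point\<close>

text \<open>
  Since \<open>B\<^sup>2 u = m\<^sup>2 u\<close> for the half return \<open>B\<close>, the vector \<open>m u - B u\<close> is multiplied by \<open>- m\<close>. The
  point of the argument is that it is not zero: \<open>u\<close> follows \<open>1322\<close>, and so does \<open>- B u\<close>, the mirror image of
  the point halfway round the orbit. The sum of two vectors following the same word follows it as well,
  hence lies in a cone without the origin.
\<close>

lemma half_return_negative_eigenvector:
  assumes f: "follows r [1, 3, 2, 2, 3, 1, 2, 2] u"
    and u: "word_matrix r [1, 3, 2, 2, 3, 1, 2, 2] *v u = m^2 *\<^sub>R u" and "0 < m"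
  shows "\<exists>w. w \<noteq> 0 \<and> half_return r *v w = (- m) *\<^sub>R w"
proof (intro exI conjI)
  let ?w = "m *\<^sub>R u + - (half_return r *v u)"
  have "follows r [1, 3, 2, 2] u" "follows r [3, 1, 2, 2] (word_matrix r [1, 3, 2, 2] *v u)"
    using f follows_append[of r "[1, 3, 2, 2]" "[3, 1, 2, 2]" u] by auto
  moreover from this(2) have "follows r [1, 3, 2, 2] (- (half_return r *v u))"
    using follows_reversal[of "[3, 1, 2, 2]" r "word_matrix r [1, 3, 2, 2] *v u"]
    unfolding half_return_apply by simp
  ultimately have "follows r [1, 3, 2, 2] ?w"
    using \<open>0 < m\<close> by (intro follows_add) (auto simp only: follows_scaleR)
  then show "?w \<noteq> 0" by (auto dest: bb_cone_nonzero)
  have "half_return r *v ?w = m *\<^sub>R (half_return r *v u) - m^2 *\<^sub>R u"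
    unfolding matrix_vector_right_distrib matrix_vector_mult_minus matrix_vector_mult_scaleR
      half_return_half_return u by simp
  then show "half_return r *v ?w = (- m) *\<^sub>R ?w"
    by (simp add: scaleR_diff_right power2_eq_square)
qed

theorem theorem7p3:
  fixes r :: real
  assumes "0 < r" and "r < 1"
  shows "\<not> (\<exists>u \<in> bb_full_domain r. generates_stably r [1, 3, 2, 2, 3, 1, 2, 2] u)"
proof
  assume "\<exists>u \<in> bb_full_domain r. generates_stably r [1, 3, 2, 2, 3, 1, 2, 2] u"
  then obtain u where "u \<in> bb_full_domain r"
    and orbit: "generates_periodic_orbit r [1, 3, 2, 2, 3, 1, 2, 2] u"
    and stable: "locally_stable r (length [1::nat, 3, 2, 2, 3, 1, 2, 2]) u"
    unfolding generates_stably_def by blast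
  then have "norm u = 1" by (auto simp: bb_full_domain_def bb_domain_eq)
  then have u: "sgn u = u" "u \<noteq> 0" by (auto simp: sgn_div_norm)
  obtain l where f: "follows r [1, 3, 2, 2, 3, 1, 2, 2] u" and "0 < l"
    and l: "word_matrix r [1, 3, 2, 2, 3, 1, 2, 2] *v u = l *\<^sub>R u"
    using generates_periodic_orbitD[OF orbit u] by blast
  define m where "m = sqrt l"
  have m: "0 < m" "l = m^2" using \<open>0 < l\<close> by (simp_all add: m_def)
  have "r < 1/7" using itinerary_impossible f assms(2) by (meson not_less)
  note large = trace_times_neg_minors_large[OF assms(1) this]
  have "(- m)^3 - half_return_trace r * (- m)^2 - half_return_neg_minors r * (- m) + r^14 = 0"
    using half_return_negative_eigenvector[OF f _ m(1)] l unfolding half_return_eigenvalue_iff m(2) by blast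
  then obtain b where b: "m < b" "b^3 - half_return_trace r * b^2 - half_return_neg_minors r * b + r^14 = 0"
    using negative_root_dominated[of m "half_return_trace r" "half_return_neg_minors r" "r^14"]
      large m(1) assms(1) by auto
  then obtain e where e: "e \<noteq> 0" "half_return r *v e = b *\<^sub>R e"
    unfolding half_return_eigenvalue_iff[symmetric] by blast
  have "word_matrix r [1, 3, 2, 2, 3, 1, 2, 2] *v e = b^2 *\<^sub>R e"
    unfolding half_return_half_return[symmetric] e(2) matrix_vector_mult_scaleR
    by (simp add: power2_eq_square)
  moreover have "l < b^2" using m b(1) by (simp add: power_strict_mono)
  ultimately show False
    using larger_eigenvalue_not_locally_stable[OF f u l _ e(1) \<open>0 < l\<close>] stable by blast
qed

end
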